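(* Fix $\lambda>0$, $\mathbf{w}_0\in\Omega$, $\alpha>1$, and $\epsilon_0>0$ with $f(\mathbf{w}_0)-f_*\le\epsilon_0$. If $f$ is semi-strongly convex on $\mathcal{S}_\epsilon$ with constant $\lambda$, then $B_\epsilon\le\sqrt{\frac{2\epsilon}{\lambda}}$ and the iteration complexity of RSG for obtaining a $2\epsilon$-optimal solution is $O\left(\frac{2\alpha^2G^2}{\lambda\epsilon}\lceil\log_\alpha(\frac{\epsilon_0}{\epsilon})\rceil\right)$. Precisely: there is a constant $C>0$ independent of $\epsilon$ such that for every $\epsilon\in(0,\epsilon_0]$ for which $f$ is semi-strongly convex on $\mathcal{S}_\epsilon$ with constant $\lambda$, one has $B_\epsilon\le\sqrt{2\epsilon/\lambda}$, and running RSG$(\mathbf{w}_0,K,t,\alpha)$ with $t=\left\lceil\frac{2\alpha^2G^2}{\lambda\epsilon}\right\rceil$ and $K=\lceil\log_\alpha(\epsilon_0/\epsilon)\rceil$ returns $\mathbf{w}_K$ with $f(\mathbf{w}_K)-f_*\le2\epsilon$ after a total number of iterations at most $C\,\frac{2\alpha^2G^2}{\lambda\epsilon}\lceil\log_\alpha(\frac{\epsilon_0}{\epsilon})\rceil$.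
   Context: Problem: $f:\mathbb{R}^d\to(-\infty,+\infty]$ is lower semicontinuous and convex, $\Omega\subseteq\mathrm{dom}(f)$ is a closed convex subset of $\mathbb{R}^d$, $f_*:=\min_{\mathbf{w}\in\Omega}f(\mathbf{w})$ is attained, and $\Omega_*\subseteq\Omega$ is the (nonempty) set of minimizers of $f$ over $\Omega$. No smoothness or strong convexity is assumed. Bounded subgradients: there is a constant $G>0$ such that for every $\mathbf{w}\in\Omega$ the subdifferential $\partial f(\mathbf{w})$ is nonempty and $\|\mathbf{v}\|_2\le G$ for all $\mathbf{v}\in\partial f(\mathbf{w})$. $\mathcal{L}_\epsilon:=\{\mathbf{w}\in\Omega:f(\mathbf{w})=f_*+\epsilon\}$, $\mathcal{S}_\epsilon:=\{\mathbf{w}\in\Omega:f(\mathbf{w})\le f_*+\epsilon\}$. For $\mathbf{w}\in\Omega$, $\mathbf{w}^*$ denotes the point of $\Omega_*$ closest to $\mathbf{w}$ in Euclidean norm. $B_\epsilon:=\sup_{\mathbf{w}\in\mathcal{L}_\epsilon}\|\mathbf{w}-\mathbf{w}^*\|_2$ (equal to $0$ if $\mathcal{L}_\epsilon=\emptyset$). $f$ is semi-strongly convex on $\mathcal{S}_\epsilon$ with constant $\lambda>0$ if $\frac{\lambda}{2}\|\mathbf{w}-\mathbf{w}^*\|_2^2\le f(\mathbf{w})-f(\mathbf{w}^* )$ for all $\mathbf{w}\in\mathcal{S}_\epsilon$. Algorithm RSG$(\mathbf{w}_0,K,t,\alpha)$ (given $\epsilon_0$ and $G$): for $k=1,\dots,K$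 let $\eta_k=\epsilon_0/(\alpha^kG^2)$; set $\mathbf{x}_1=\mathbf{w}_{k-1}$ and, for $\tau=1,\dots,t$, $\mathbf{x}_{\tau+1}=\Pi_\Omega[\mathbf{x}_\tau-\eta_k\mathbf{g}_\tau]$, where $\mathbf{g}_\tau\in\partial f(\mathbf{x}_\tau)$ is an arbitrary subgradient returned by an oracle and $\Pi_\Omega$ is the Euclidean projection onto $\Omega$; set $\mathbf{w}_k=\frac1t\sum_{\tau=1}^t\mathbf{x}_\tau$. Output $\mathbf{w}_K$. Each $k$ is a stage; each $\tau$ within a stage is one iteration, so the total number of iterations is $tK$. *)

theory Defs
  imports "HOL-Analysis.Analysis"
begin

section \<open>Extended-real-valued convex functions\<close>

definition edom :: "('a \<Rightarrow> ereal) \<Rightarrow> 'a set" where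
  "edom f = {x. f x < \<infinity>}"

text \<open>The library's \<open>convex_on\<close> is restricted to real-valued functions.  For functions that never
  take the value \<open>-\<infinity>\<close> no term \<open>\<infinity> - \<infinity>\<close> arises on the right-hand side, and \<open>0 * \<infinity> = 0\<close>.\<close>

definition econvex :: "('a::real_vector \<Rightarrow> ereal) \<Rightarrow> bool" where
  "econvex f \<longleftrightarrow> (\<forall>x y. \<forall>u\<ge>0. \<forall>v\<ge>0. u + v = 1 \<longrightarrow>
     f (u *\<^sub>R x + v *\<^sub>R y) \<le> ereal u * f x + ereal v * f y)"

definition lower_semicontinuous :: "('a::topological_space \<Rightarrow> ereal) \<Rightarrow> bool" where
  "lower_semicontinuous f \<longleftrightarrow> (\<forall>x. f x \<le> Liminf (at x) f)"

definition subdifferential :: "('a::real_inner \<Rightarrow> ereal) \<Rightarrow> 'a \<Rightarrow> 'a set" where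
  "subdifferential f w = {v. \<forall>x. f w + ereal (v \<bullet> (x - w)) \<le> f x}"

section \<open>The constrained minimization problem\<close>

definition fmin :: "('a \<Rightarrow> ereal) \<Rightarrow> 'a set \<Rightarrow> ereal" where
  "fmin f \<Omega> = (INF w\<in>\<Omega>. f w)"

definition minimizers :: "('a \<Rightarrow> ereal) \<Rightarrow> 'a set \<Rightarrow> 'a set" where
  "minimizers f \<Omega> = {w\<in>\<Omega>. \<forall>x\<in>\<Omega>. f w \<le> f x}"

definition level_set :: "('a \<Rightarrow> ereal) \<Rightarrow> 'a set \<Rightarrow> real \<Rightarrow> 'a set" where
  "level_set f \<Omega> \<epsilon> = {w\<in>\<Omega>. f w = fmin f \<Omega> + ereal \<epsilon>}"

definition sublevel_set :: "('a \<Rightarrow> ereal) \<Rightarrow> 'a set \<Rightarrow> real \<Rightarrow> 'a set" where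
  "sublevel_set f \<Omega> \<epsilon> = {w\<in>\<Omega>. f w \<le> fmin f \<Omega> + ereal \<epsilon>}"

definition nearest_minimizer :: "('a::euclidean_space \<Rightarrow> ereal) \<Rightarrow> 'a set \<Rightarrow> 'a \<Rightarrow> 'a" where
  "nearest_minimizer f \<Omega> w = closest_point (minimizers f \<Omega>) w"

text \<open>The supremum is taken in the extended reals, so that a real upper bound on it also asserts
  that the distances are bounded.  The supremum of the empty set would be \<open>-\<infinity>\<close> there.\<close>

definition level_set_radius :: "('a::euclidean_space \<Rightarrow> ereal) \<Rightarrow> 'a set \<Rightarrow> real \<Rightarrow> ereal" where
  "level_set_radius f \<Omega> \<epsilon> =
     (if level_set f \<Omega> \<epsilon> = {} then 0
      else (SUP w\<in>level_set f \<Omega> \<epsilon>. ereal (norm (w - nearest_minimizer f \<Omega> w))))"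

definition semi_strongly_convex_on ::
    "('a::euclidean_space \<Rightarrow> ereal) \<Rightarrow> 'a set \<Rightarrow> real \<Rightarrow> 'a set \<Rightarrow> bool" where
  "semi_strongly_convex_on f \<Omega> lam S \<longleftrightarrow>
     (\<forall>w\<in>S. ereal (lam / 2 * (norm (w - nearest_minimizer f \<Omega> w))\<^sup>2)
              \<le> f w - f (nearest_minimizer f \<Omega> w))"

section \<open>The restarted subgradient method\<close>

text \<open>An oracle receives the stage \<open>k\<close>, the iteration \<open>\<tau>\<close> and the current point.  Since it may
  depend on \<open>k\<close> and \<open>\<tau>\<close>, quantifying over all oracles covers every possible choice of subgradients
  along a run, including different ones at a point that is visited repeatedly.\<close>

definition subgradient_oracle ::
    "('a::real_inner \<Rightarrow> ereal) \<Rightarrow> 'a set \<Rightarrow> (nat \<Rightarrow> nat \<Rightarrow> 'a \<Rightarrow> 'a) \<Rightarrow> bool" where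
  "subgradient_oracle f \<Omega> orc \<longleftrightarrow> (\<forall>k \<tau>. \<forall>x\<in>\<Omega>. orc k \<tau> x \<in> subdifferential f x)"

text \<open>The value at index \<open>n\<close> is the iterate \<open>x\<^sub>\<tau>\<close> with \<open>\<tau> = n + 1\<close>; accordingly the sum in \<open>sg_stage\<close>
  over \<open>n < t\<close> runs over \<open>\<tau> = 1, \<dots>, t\<close>.\<close>

primrec sg_iterate ::
    "'a::euclidean_space set \<Rightarrow> (nat \<Rightarrow> 'a \<Rightarrow> 'a) \<Rightarrow> real \<Rightarrow> 'a \<Rightarrow> nat \<Rightarrow> 'a" where
  "sg_iterate \<Omega> g \<eta> x 0 = x"
| "sg_iterate \<Omega> g \<eta> x (Suc n) =
     closest_point \<Omega> (sg_iterate \<Omega> g \<eta> x n - \<eta> *\<^sub>R g (Suc n) (sg_iterate \<Omega> g \<eta> x n))"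

definition sg_stage ::
    "'a::euclidean_space set \<Rightarrow> (nat \<Rightarrow> 'a \<Rightarrow> 'a) \<Rightarrow> real \<Rightarrow> nat \<Rightarrow> 'a \<Rightarrow> 'a" where
  "sg_stage \<Omega> g \<eta> t x = (1 / real t) *\<^sub>R (\<Sum>n<t. sg_iterate \<Omega> g \<eta> x n)"

primrec rsg :: "'a::euclidean_space set \<Rightarrow> (nat \<Rightarrow> nat \<Rightarrow> 'a \<Rightarrow> 'a) \<Rightarrow> real \<Rightarrow> real \<Rightarrow>
    'a \<Rightarrow> nat \<Rightarrow> nat \<Rightarrow> real \<Rightarrow> 'a" where
  "rsg \<Omega> orc \<epsilon>\<^sub>0 G w\<^sub>0 0 t \<alpha> = w\<^sub>0"
| "rsg \<Omega> orc \<epsilon>\<^sub>0 G w\<^sub>0 (Suc k) t \<alpha> =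
     sg_stage \<Omega> (orc (Suc k)) (\<epsilon>\<^sub>0 / (\<alpha> ^ Suc k * G\<^sup>2)) t (rsg \<Omega> orc \<epsilon>\<^sub>0 G w\<^sub>0 k t \<alpha>)"

definition rsg_iterations :: "nat \<Rightarrow> nat \<Rightarrow> nat" where
  "rsg_iterations K t = t * K"

end

theory Submission
  imports Defs
begin

text \<open>Write \<open>m\<close> for the minimum of \<open>f\<close> over \<open>\<Omega>\<close>, \<open>\<epsilon>\<^sub>k\<close> for \<open>\<epsilon>\<^sub>0 / \<alpha>^k\<close> and \<open>\<lambda>\<close> for \<open>lam\<close>.  The bound
  on \<open>B\<^sub>\<epsilon>\<close> is the growth condition read off at a point where \<open>f\<close> equals \<open>m + \<epsilon>\<close>.  For the
  complexity, each stage preserves the invariant \<open>f w\<^sub>k \<le> m + \<epsilon> + \<epsilon>\<^sub>k\<close> (\<open>rsg_invariant\<close>); once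
  \<open>\<alpha>^K \<ge> \<epsilon>\<^sub>0 / \<epsilon>\<close>, this is the claim.

  A stage of the projected subgradient method run from \<open>x\<close> with step size \<open>\<eta>\<close> produces an
  average \<open>y\<close> of its iterates with \<open>f y - f u \<le> \<parallel>x - u\<parallel>\<^sup>2 / (2 \<eta> t) + \<eta> G\<^sup>2 / 2\<close> for every
  comparison point \<open>u \<in> \<Omega>\<close> (\<open>sg_stage_suboptimality\<close>).  The idea is to compare not with a
  minimizer, which may be far away, but with a point of the \<open>\<epsilon>\<close>-sublevel set, which the growth
  condition makes close on the scale of the current error: if \<open>f w \<le> m + \<epsilon> + \<delta>\<close>, some \<open>u\<close> with
  \<open>f u \<le> m + \<epsilon>\<close> has \<open>\<parallel>w - u\<parallel>\<^sup>2 \<le> 2 \<delta>\<^sup>2 / (\<lambda> \<epsilon>)\<close> (\<open>sublevel_point_near\<close>).  This \<open>u\<close> lies on the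
  segment from \<open>w\<close> to its nearest minimizer \<open>w\<^sup>*\<close>; since \<open>w\<^sup>*\<close> is also the minimizer nearest to
  \<open>u\<close>, the growth condition, although it is only available on the sublevel set, bounds
  \<open>\<parallel>u - w\<^sup>*\<parallel>\<close>, and convexity along the segment carries that bound over to \<open>\<parallel>w - u\<parallel>\<close>.

  By the invariant, stage \<open>k\<close> starts with an excess over \<open>m + \<epsilon>\<close> of at most
  \<open>\<delta> = \<epsilon>\<^sub>k\<^sub>-\<^sub>1 = \<alpha> \<epsilon>\<^sub>k\<close>.  With \<open>\<eta> = \<epsilon>\<^sub>k / G\<^sup>2\<close> and \<open>t \<ge> 2 \<alpha>\<^sup>2 G\<^sup>2 / (\<lambda> \<epsilon>)\<close>, both terms of the
  stage bound are at most \<open>\<epsilon>\<^sub>k / 2\<close>, which restores the invariant.\<close>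

section \<open>Geometry of the sublevel sets\<close>

text \<open>Any point of \<open>S\<close> nearer to \<open>u\<close> would, by the triangle inequality through \<open>u\<close>, also be
  nearer to \<open>w\<close>.\<close>

lemma closest_point_on_segment:
  fixes S :: "'a::euclidean_space set"
  assumes "convex S" "closed S" "S \<noteq> {}" "u \<in> closed_segment w (closest_point S w)"
  shows "closest_point S u = closest_point S w"
proof -
  let ?p = "closest_point S w"
  have "dist u ?p \<le> dist u z" if "z \<in> S" for z
  proof -
    have "dist w u + dist u ?p = dist w ?p"
      using assms(4) by (metis between between_mem_segment)
    also have "\<dots> \<le> dist w z"
      using closest_point_le[OF assms(2) that] .
    also have "\<dots> \<le> dist w u + dist u z"
      by (rule dist_triangle)
    finally show ?thesis by simp
  qed
  then show ?thesis
    using closest_point_unique[OF assms(1,2) closest_point_in_set[OF assms(2,3)]] by metis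
qed

text \<open>Quadratic growth inside the \<open>\<epsilon>\<close>-sublevel set controls distances outside it: convexity forces
  \<open>h\<close> to keep increasing along the segment that leaves the sublevel set at least as fast as it did
  on average up to there.\<close>

lemma sublevel_point_near:
  fixes h :: "'a::euclidean_space \<Rightarrow> real"
  assumes M: "convex M" "closed M" "M \<noteq> {}" "M \<subseteq> \<Omega>" "\<And>z. z \<in> M \<Longrightarrow> h z = m"
    and h: "convex_on \<Omega> h"
    and growth: "\<And>x. x \<in> \<Omega> \<Longrightarrow> h x \<le> m + \<epsilon> \<Longrightarrow>
                   lam / 2 * (norm (x - closest_point M x))\<^sup>2 \<le> h x - m"
    and pos: "lam > 0" "\<epsilon> > 0" "\<delta> \<ge> 0"
    and w: "w \<in> \<Omega>" "h w \<le> m + \<epsilon> + \<delta>"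
  obtains u where "u \<in> \<Omega>" "h u \<le> m + \<epsilon>" "(norm (w - u))\<^sup>2 \<le> 2 * \<delta>\<^sup>2 / (lam * \<epsilon>)"
proof (cases "h w \<le> m + \<epsilon>")
  case True
  then show ?thesis
    using that[of w] w(1) pos by simp
next
  case False
  define d where "d = h w - m"
  define \<theta> where "\<theta> = \<epsilon> / d"
  define p where "p = closest_point M w"
  \<comment> \<open>\<open>\<theta>\<close> is chosen so that linear interpolation of the values \<open>m\<close> and \<open>m + d\<close> at the endpoints
    of the segment gives \<open>m + \<epsilon>\<close>.\<close>
  define u where "u = (1 - \<theta>) *\<^sub>R p + \<theta> *\<^sub>R w"
  have d: "d > \<epsilon>" "d > 0" "d - \<epsilon> \<le> \<delta>"
    using False w(2) pos by (auto simp: d_def)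
  have \<theta>: "0 < \<theta>" "\<theta> < 1" "\<theta> * d = \<epsilon>"
    using d pos by (auto simp: \<theta>_def)
  have p: "p \<in> M" "p \<in> \<Omega>" "h p = m"
    using closest_point_in_set[OF M(2,3)] M(4,5) by (auto simp: p_def)
  have u\<Omega>: "u \<in> \<Omega>"
    using p(2) w(1) \<theta> h
    by (auto simp: u_def convex_on_def intro!: convexD)
  have "h u \<le> (1 - \<theta>) * h p + \<theta> * h w"
    unfolding u_def using convex_onD[OF h, of \<theta> p w] \<theta> p w by simp
  also have "\<dots> = m + \<theta> * d"
    by (simp add: p(3) d_def algebra_simps)
  finally have hu: "h u \<le> m + \<epsilon>"
    using \<theta> by simp
  have "u \<in> closed_segment w p"
    unfolding closed_segment_commute[of w] in_segment u_def
    using \<theta> by (intro exI[of _ \<theta>]) simp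
  then have "closest_point M u = p"
    using closest_point_on_segment[OF M(1-3)] unfolding p_def by blast
  moreover have up: "u - p = \<theta> *\<^sub>R (w - p)" and wu: "w - u = (1 - \<theta>) *\<^sub>R (w - p)"
    by (auto simp: u_def algebra_simps)
  ultimately have "lam / 2 * (\<theta> * norm (w - p))\<^sup>2 \<le> \<epsilon>"
    using growth[OF u\<Omega> hu] hu \<theta> by simp
  then have "lam * \<epsilon> * (\<theta> * norm (w - p))\<^sup>2 \<le> 2 * \<epsilon>\<^sup>2"
    using pos by (simp add: power2_eq_square field_simps)
  then have "lam * \<epsilon> * (norm (w - p))\<^sup>2 * \<epsilon>\<^sup>2 \<le> 2 * d\<^sup>2 * \<epsilon>\<^sup>2"
    using d by (simp add: \<theta>_def power_mult_distrib power_divide field_simps)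
  then have wp: "lam * \<epsilon> * (norm (w - p))\<^sup>2 \<le> 2 * d\<^sup>2"
    using pos by simp
  have "lam * \<epsilon> * (norm (w - u))\<^sup>2 = (1 - \<theta>)\<^sup>2 * (lam * \<epsilon> * (norm (w - p))\<^sup>2)"
    using \<theta> by (simp add: wu power_mult_distrib)
  also have "\<dots> \<le> (1 - \<theta>)\<^sup>2 * (2 * d\<^sup>2)"
    using wp by (rule mult_left_mono) simp
  also have "\<dots> = 2 * (d - \<theta> * d)\<^sup>2"
    by (simp add: power2_eq_square algebra_simps)
  also have "\<dots> \<le> 2 * \<delta>\<^sup>2"
    using \<theta>(3) d by (simp add: power_mono)
  finally have "(norm (w - u))\<^sup>2 \<le> 2 * \<delta>\<^sup>2 / (lam * \<epsilon>)"
    using pos by (simp add: field_simps)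
  then show ?thesis
    using that u\<Omega> hu by blast
qed

section \<open>One stage of the projected subgradient method\<close>

definition bounded_subgradients_on ::
    "'a::real_inner set \<Rightarrow> ('a \<Rightarrow> real) \<Rightarrow> real \<Rightarrow> ('a \<Rightarrow> 'a) \<Rightarrow> bool" where
  "bounded_subgradients_on \<Omega> h G g \<longleftrightarrow>
     (\<forall>x\<in>\<Omega>. norm (g x) \<le> G \<and> (\<forall>y\<in>\<Omega>. h x + g x \<bullet> (y - x) \<le> h y))"

lemma sg_iterate_in:
  assumes "closed \<Omega>" "x \<in> \<Omega>"
  shows "sg_iterate \<Omega> g \<eta> x n \<in> \<Omega>"
  using assms by (cases n) (auto intro: closest_point_in_set)

lemma sg_stage_in:
  assumes "convex \<Omega>" "closed \<Omega>" "x \<in> \<Omega>" "t > 0"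
  shows "sg_stage \<Omega> g \<eta> t x \<in> \<Omega>"
  unfolding sg_stage_def scaleR_right.sum
  using assms by (intro convex_sum) (auto intro: sg_iterate_in)

text \<open>Projecting onto \<open>\<Omega>\<close> does not increase the distance to a point of \<open>\<Omega>\<close>, so a step may be
  estimated as if it were unprojected.\<close>

lemma projected_subgradient_step:
  fixes x u :: "'a::euclidean_space"
  assumes \<Omega>: "convex \<Omega>" "closed \<Omega>" "x \<in> \<Omega>" "u \<in> \<Omega>"
    and g: "bounded_subgradients_on \<Omega> h G g" and "\<eta> \<ge> 0"
  shows "2 * \<eta> * (h x - h u) \<le>
    (norm (x - u))\<^sup>2 - (norm (closest_point \<Omega> (x - \<eta> *\<^sub>R g x) - u))\<^sup>2 + \<eta>\<^sup>2 * G\<^sup>2"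
proof -
  have gx: "norm (g x) \<le> G" "h x - h u \<le> g x \<bullet> (x - u)"
    using g \<Omega> unfolding bounded_subgradients_on_def by (force simp: inner_diff_right)+
  have "norm (closest_point \<Omega> (x - \<eta> *\<^sub>R g x) - u) \<le> norm (x - \<eta> *\<^sub>R g x - u)"
    using closest_point_lipschitz[OF \<Omega>(1,2), of "x - \<eta> *\<^sub>R g x" u] \<Omega>
    by (auto simp: closest_point_self dist_norm)
  then have "(norm (closest_point \<Omega> (x - \<eta> *\<^sub>R g x) - u))\<^sup>2 \<le> (norm (x - \<eta> *\<^sub>R g x - u))\<^sup>2"
    by (simp add: power_mono)
  also have "\<dots> = (norm (x - u))\<^sup>2 - 2 * \<eta> * (g x \<bullet> (x - u)) + \<eta>\<^sup>2 * (norm (g x))\<^sup>2"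
    using dot_norm_neg[of "x - u" "\<eta> *\<^sub>R g x"]
    by (simp add: power_mult_distrib inner_commute algebra_simps)
  also have "\<dots> \<le> (norm (x - u))\<^sup>2 - 2 * \<eta> * (h x - h u) + \<eta>\<^sup>2 * G\<^sup>2"
  proof -
    have "\<eta> * (h x - h u) \<le> \<eta> * (g x \<bullet> (x - u))" "\<eta>\<^sup>2 * (norm (g x))\<^sup>2 \<le> \<eta>\<^sup>2 * G\<^sup>2"
      using gx \<open>\<eta> \<ge> 0\<close> by (auto intro!: mult_left_mono power_mono)
    then show ?thesis by linarith
  qed
  finally show ?thesis by simp
qed

text \<open>The squared distances to \<open>u\<close> telescope.\<close>

lemma sg_iterate_regret:
  fixes x u :: "'a::euclidean_space"
  assumes \<Omega>: "convex \<Omega>" "closed \<Omega>" "x \<in> \<Omega>" "u \<in> \<Omega>"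
    and g: "\<And>n. bounded_subgradients_on \<Omega> h G (g n)" and "\<eta> \<ge> 0"
  shows "2 * \<eta> * (\<Sum>n<t. h (sg_iterate \<Omega> g \<eta> x n) - h u)
     \<le> (norm (x - u))\<^sup>2 - (norm (sg_iterate \<Omega> g \<eta> x t - u))\<^sup>2 + real t * (\<eta>\<^sup>2 * G\<^sup>2)"
proof (induction t)
  case 0
  then show ?case by simp
next
  case (Suc t)
  have "2 * \<eta> * (h (sg_iterate \<Omega> g \<eta> x t) - h u) \<le>
    (norm (sg_iterate \<Omega> g \<eta> x t - u))\<^sup>2 - (norm (sg_iterate \<Omega> g \<eta> x (Suc t) - u))\<^sup>2 + \<eta>\<^sup>2 * G\<^sup>2"
    using projected_subgradient_step[OF \<Omega>(1,2) sg_iterate_in[OF \<Omega>(2,3)] \<Omega>(4) g \<open>\<eta> \<ge> 0\<close>] by simp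
  with Suc show ?case
    by (simp add: distrib_left distrib_right)
qed

lemma sg_stage_suboptimality:
  fixes x u :: "'a::euclidean_space"
  assumes \<Omega>: "closed \<Omega>" "x \<in> \<Omega>" "u \<in> \<Omega>" and h: "convex_on \<Omega> h"
    and g: "\<And>n. bounded_subgradients_on \<Omega> h G (g n)" and pos: "\<eta> > 0" "t > 0"
  shows "h (sg_stage \<Omega> g \<eta> t x) - h u
     \<le> (norm (x - u))\<^sup>2 / (2 * \<eta> * real t) + \<eta> * G\<^sup>2 / 2"
proof -
  let ?X = "sg_iterate \<Omega> g \<eta> x"
  have conv: "convex \<Omega>"
    using h by (simp add: convex_on_def)
  have "h (sg_stage \<Omega> g \<eta> t x) \<le> (\<Sum>n<t. 1 / real t * h (?X n))"
    unfolding sg_stage_def scaleR_right.sum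
    using pos h by (intro convex_on_sum) (auto intro: sg_iterate_in \<Omega>)
  then have "h (sg_stage \<Omega> g \<eta> t x) - h u \<le> (\<Sum>n<t. h (?X n) - h u) / real t"
    using pos by (simp add: sum_subtractf sum_divide_distrib diff_divide_distrib)
  also have "\<dots> \<le> ((norm (x - u))\<^sup>2 + real t * (\<eta>\<^sup>2 * G\<^sup>2)) / (2 * \<eta>) / real t"
  proof (rule divide_right_mono)
    have "2 * \<eta> * (\<Sum>n<t. h (?X n) - h u) \<le> (norm (x - u))\<^sup>2 + real t * (\<eta>\<^sup>2 * G\<^sup>2)"
      using sg_iterate_regret[where g = g, OF conv \<Omega> g, of \<eta> t] pos
        zero_le_power2[of "norm (?X t - u)"] by linarith
    then show "(\<Sum>n<t. h (?X n) - h u) \<le> ((norm (x - u))\<^sup>2 + real t * (\<eta>\<^sup>2 * G\<^sup>2)) / (2 * \<eta>)"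
      using pos by (simp add: pos_le_divide_eq mult.commute)
  qed simp
  also have "\<dots> = (norm (x - u))\<^sup>2 / (2 * \<eta> * real t) + \<eta> * G\<^sup>2 / 2"
    using pos by (simp add: field_simps power2_eq_square)
  finally show ?thesis .
qed

section \<open>The restarted method\<close>

lemma rsg_invariant:
  fixes h :: "'a::euclidean_space \<Rightarrow> real"
  assumes M: "convex M" "closed M" "M \<noteq> {}" "M \<subseteq> \<Omega>" "\<And>z. z \<in> M \<Longrightarrow> h z = m"
    and h: "convex_on \<Omega> h" and "closed \<Omega>"
    and growth: "\<And>x. x \<in> \<Omega> \<Longrightarrow> h x \<le> m + \<epsilon> \<Longrightarrow>
                   lam / 2 * (norm (x - closest_point M x))\<^sup>2 \<le> h x - m"
    and orc: "\<And>k n. bounded_subgradients_on \<Omega> h G (orc k n)"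
    and pos: "lam > 0" "\<epsilon> > 0" "\<epsilon>\<^sub>0 > 0" "\<alpha> > 1" "G > 0"
    and w\<^sub>0: "w\<^sub>0 \<in> \<Omega>" "h w\<^sub>0 \<le> m + \<epsilon>\<^sub>0"
    and t: "2 * \<alpha>\<^sup>2 * G\<^sup>2 / (lam * \<epsilon>) \<le> real t"
  shows "rsg \<Omega> orc \<epsilon>\<^sub>0 G w\<^sub>0 k t \<alpha> \<in> \<Omega> \<and>
         h (rsg \<Omega> orc \<epsilon>\<^sub>0 G w\<^sub>0 k t \<alpha>) \<le> m + \<epsilon> + \<epsilon>\<^sub>0 / \<alpha> ^ k"
proof (induction k)
  case 0
  then show ?case using w\<^sub>0 pos by simp
next
  case (Suc k)
  let ?w = "rsg \<Omega> orc \<epsilon>\<^sub>0 G w\<^sub>0 k t \<alpha>"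
  define \<delta> where "\<delta> = \<epsilon>\<^sub>0 / \<alpha> ^ Suc k"
  define \<eta> where "\<eta> = \<delta> / G\<^sup>2"
  have next_w: "rsg \<Omega> orc \<epsilon>\<^sub>0 G w\<^sub>0 (Suc k) t \<alpha> = sg_stage \<Omega> (orc (Suc k)) \<eta> t ?w"
    by (simp add: \<eta>_def \<delta>_def)
  have \<delta>: "\<delta> > 0" "\<alpha> * \<delta> = \<epsilon>\<^sub>0 / \<alpha> ^ k" and \<eta>: "\<eta> > 0" "\<eta> * G\<^sup>2 = \<delta>"
    using pos by (auto simp: \<delta>_def \<eta>_def)
  have "0 < 2 * \<alpha>\<^sup>2 * G\<^sup>2 / (lam * \<epsilon>)"
    using pos by simp
  with t have tpos: "t > 0"
    by (cases t) auto
  have w: "?w \<in> \<Omega>" "h ?w \<le> m + \<epsilon> + \<alpha> * \<delta>"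
    using Suc \<delta> by auto
  have "\<alpha> * \<delta> \<ge> 0"
    using \<delta> pos by simp
  then obtain u where u: "u \<in> \<Omega>" "h u \<le> m + \<epsilon>"
      "(norm (?w - u))\<^sup>2 \<le> 2 * (\<alpha> * \<delta>)\<^sup>2 / (lam * \<epsilon>)"
    using sublevel_point_near[OF M h growth pos(1,2) _ w] by blast
  \<comment> \<open>The distance term is at most \<open>\<delta> / 2\<close>; this is where the number of iterations per stage is
    determined.\<close>
  have "(norm (?w - u))\<^sup>2 \<le> \<delta> * \<eta> * (2 * \<alpha>\<^sup>2 * G\<^sup>2 / (lam * \<epsilon>))"
    using u(3) pos by (simp add: \<eta>_def power_mult_distrib power2_eq_square mult_ac)
  also have "\<dots> \<le> \<delta> * \<eta> * real t"
    using t \<delta> \<eta> by (intro mult_left_mono) auto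
  finally have "(norm (?w - u))\<^sup>2 / (2 * \<eta> * real t) \<le> \<delta> / 2"
    using \<eta> tpos by (simp add: field_simps)
  then have "h (sg_stage \<Omega> (orc (Suc k)) \<eta> t ?w) - h u \<le> \<delta>"
    using sg_stage_suboptimality[where g = "orc (Suc k)", OF \<open>closed \<Omega>\<close> w(1) u(1) h orc \<eta>(1) tpos] \<eta>
    by simp
  moreover have "sg_stage \<Omega> (orc (Suc k)) \<eta> t ?w \<in> \<Omega>"
    using sg_stage_in h w(1) \<open>closed \<Omega>\<close> tpos by (auto simp: convex_on_def)
  ultimately show ?case
    unfolding next_w using u(2) by (simp add: \<delta>_def)
qed

lemma geometric_error_after_log_stages:
  assumes "\<alpha> > 1" "\<epsilon> > 0" "\<epsilon>\<^sub>0 > 0"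
  shows "\<epsilon>\<^sub>0 / \<alpha> ^ nat \<lceil>log \<alpha> (\<epsilon>\<^sub>0 / \<epsilon>)\<rceil> \<le> \<epsilon>"
proof -
  let ?K = "nat \<lceil>log \<alpha> (\<epsilon>\<^sub>0 / \<epsilon>)\<rceil>"
  have "log \<alpha> (\<epsilon>\<^sub>0 / \<epsilon>) \<le> real ?K"
    by linarith
  then have "\<epsilon>\<^sub>0 / \<epsilon> \<le> \<alpha> powr real ?K"
    using assms by (simp add: log_le_iff)
  then show ?thesis
    using assms by (simp add: powr_realpow field_simps)
qed

text \<open>Rounding \<open>X\<close> up costs at most a constant factor as long as \<open>X\<close> is bounded away from \<open>0\<close>.  This
  is why the constant in the theorem depends on \<open>\<epsilon>\<^sub>0\<close>.\<close>

lemma rsg_iterations_le: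
  fixes X Y c :: real
  assumes "c > 0" "c \<le> X" "Y \<ge> 0"
  shows "real (rsg_iterations (nat \<lceil>Y\<rceil>) (nat \<lceil>X\<rceil>)) \<le> (1 + 1 / c) * X * of_int \<lceil>Y\<rceil>"
proof -
  have "real (nat \<lceil>X\<rceil>) \<le> X + 1"
    using assms by linarith
  also have "\<dots> \<le> (1 + 1 / c) * X"
    using assms by (simp add: field_simps)
  finally have "real (nat \<lceil>X\<rceil>) * real (nat \<lceil>Y\<rceil>) \<le> (1 + 1 / c) * X * real (nat \<lceil>Y\<rceil>)"
    by (rule mult_right_mono) simp
  moreover have "real (nat \<lceil>Y\<rceil>) = of_int \<lceil>Y\<rceil>"
    using assms by simp
  ultimately show ?thesis
    by (simp add: rsg_iterations_def)
qed

section \<open>Passing to real values\<close>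

lemma econvex_imp_convex_on:
  fixes f :: "'a::real_vector \<Rightarrow> ereal"
  assumes "econvex f" "convex \<Omega>" "\<And>x. x \<in> \<Omega> \<Longrightarrow> f x = ereal (h x)"
  shows "convex_on \<Omega> h"
  unfolding convex_on_def
proof (intro conjI ballI allI impI assms(2))
  fix x y :: 'a and u v :: real
  assume *: "x \<in> \<Omega>" "y \<in> \<Omega>" "0 \<le> u" "0 \<le> v" "u + v = 1"
  then have "f (u *\<^sub>R x + v *\<^sub>R y) \<le> ereal u * f x + ereal v * f y"
    using assms(1) unfolding econvex_def by blast
  moreover have "u *\<^sub>R x + v *\<^sub>R y \<in> \<Omega>"
    using * assms(2) by (auto intro: convexD)
  ultimately show "h (u *\<^sub>R x + v *\<^sub>R y) \<le> u * h x + v * h y"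
    using * assms(3) by simp
qed

text \<open>Continuity makes the set of minimizers closed, so that nearest minimizers exist.\<close>

lemma bounded_subgradients_imp_continuous_on:
  assumes "bounded_subgradients_on \<Omega> h G g"
  shows "continuous_on \<Omega> h"
proof -
  have "h x - h y \<le> G * dist x y" if "x \<in> \<Omega>" "y \<in> \<Omega>" for x y
  proof -
    have "h x - h y \<le> g x \<bullet> (x - y)"
      using assms that unfolding bounded_subgradients_on_def by (force simp: inner_diff_right)
    also have "\<dots> \<le> norm (g x) * norm (x - y)"
      by (rule norm_cauchy_schwarz)
    also have "\<dots> \<le> G * dist x y"
      using assms that unfolding bounded_subgradients_on_def dist_norm
      by (intro mult_right_mono) auto
    finally show ?thesis .
  qed
  \<comment> \<open>Only \<open>\<bar>G\<bar>\<close> is sure to be a Lipschitz constant, as \<open>G\<close> may be negative if \<open>\<Omega>\<close> is empty.\<close>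
  then have "\<bar>G\<bar>-lipschitz_on \<Omega> h"
    by (intro lipschitz_onI)
       (smt (verit) dist_commute dist_real_def mult_right_mono zero_le_dist, simp)
  then show ?thesis
    by (rule lipschitz_on_continuous_on)
qed

theorem corollary11:
  fixes f :: "real ^ 'd \<Rightarrow> ereal" and \<Omega> :: "(real ^ 'd) set"
    and G lam \<alpha> \<epsilon>\<^sub>0 :: real and w\<^sub>0 :: "real ^ 'd"
  assumes "\<And>x. f x \<noteq> -\<infinity>"
    and "lower_semicontinuous f"
    and "econvex f"
    and "closed \<Omega>" and "convex \<Omega>" and "\<Omega> \<subseteq> edom f"
    and "minimizers f \<Omega> \<noteq> {}"
    and "G > 0"
    and "\<And>w. w \<in> \<Omega> \<Longrightarrow> subdifferential f w \<noteq> {}"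
    and "\<And>w v. w \<in> \<Omega> \<Longrightarrow> v \<in> subdifferential f w \<Longrightarrow> norm v \<le> G"
    and "lam > 0" and "w\<^sub>0 \<in> \<Omega>" and "\<alpha> > 1" and "\<epsilon>\<^sub>0 > 0"
    and "f w\<^sub>0 - fmin f \<Omega> \<le> ereal \<epsilon>\<^sub>0"
  shows "\<exists>C>0. \<forall>\<epsilon>. 0 < \<epsilon> \<and> \<epsilon> \<le> \<epsilon>\<^sub>0 \<and>
           semi_strongly_convex_on f \<Omega> lam (sublevel_set f \<Omega> \<epsilon>) \<longrightarrow>
           level_set_radius f \<Omega> \<epsilon> \<le> ereal (sqrt (2 * \<epsilon> / lam)) \<and>
           (let t = nat \<lceil>2 * \<alpha>\<^sup>2 * G\<^sup>2 / (lam * \<epsilon>)\<rceil>;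
                K = nat \<lceil>log \<alpha> (\<epsilon>\<^sub>0 / \<epsilon>)\<rceil>
            in (\<forall>orc. subgradient_oracle f \<Omega> orc \<longrightarrow>
                  f (rsg \<Omega> orc \<epsilon>\<^sub>0 G w\<^sub>0 K t \<alpha>) - fmin f \<Omega> \<le> ereal (2 * \<epsilon>)) \<and>
               real (rsg_iterations K t)
                 \<le> C * (2 * \<alpha>\<^sup>2 * G\<^sup>2 / (lam * \<epsilon>)) * of_int \<lceil>log \<alpha> (\<epsilon>\<^sub>0 / \<epsilon>)\<rceil>)"
proof -
  define h where "h x = real_of_ereal (f x)" for x
  define M where "M = minimizers f \<Omega>"
  have fh: "f x = ereal (h x)" if "x \<in> \<Omega>" for x
    using assms(1)[of x] assms(6) that unfolding h_def edom_def
    by (cases "f x") auto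
  obtain z\<^sub>0 where z\<^sub>0: "z\<^sub>0 \<in> \<Omega>" "\<And>x. x \<in> \<Omega> \<Longrightarrow> f z\<^sub>0 \<le> f x"
    using assms(7) unfolding minimizers_def by auto
  define m where "m = h z\<^sub>0"
  have fmin: "fmin f \<Omega> = ereal m"
    unfolding fmin_def m_def fh[OF z\<^sub>0(1), symmetric]
    using z\<^sub>0 by (intro antisym INF_lower INF_greatest)
  have m_le: "m \<le> h x" if "x \<in> \<Omega>" for x
    using z\<^sub>0(2)[OF that] fh that z\<^sub>0(1) by (simp add: m_def)
  have M_eq: "M = {x \<in> \<Omega>. h x \<le> m}"
  proof -
    have "(\<forall>y\<in>\<Omega>. f x \<le> f y) \<longleftrightarrow> h x \<le> m" if "x \<in> \<Omega>" for x
      using that z\<^sub>0(1) m_le fh by (auto simp: m_def intro: order_trans)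
    then show ?thesis
      unfolding M_def minimizers_def by blast
  qed
  have conv: "convex_on \<Omega> h"
    using econvex_imp_convex_on[OF assms(3,5) fh] by simp
  have sub: "bounded_subgradients_on \<Omega> h G g"
    if "\<And>x. x \<in> \<Omega> \<Longrightarrow> g x \<in> subdifferential f x" for g
    unfolding bounded_subgradients_on_def
  proof (intro ballI conjI)
    fix x y assume xy: "x \<in> \<Omega>" "y \<in> \<Omega>"
    have "f x + ereal (g x \<bullet> (y - x)) \<le> f y"
      using that[OF xy(1)] unfolding subdifferential_def by blast
    then show "h x + g x \<bullet> (y - x) \<le> h y"
      using fh xy by simp
  qed (use that assms(10) in blast)
  have "bounded_subgradients_on \<Omega> h G (\<lambda>x. SOME v. v \<in> subdifferential f x)"
    by (rule sub) (use assms(9) some_in_eq in blast)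
  then have cont: "continuous_on \<Omega> h"
    by (rule bounded_subgradients_imp_continuous_on)
  have M: "convex M" "closed M" "M \<noteq> {}" "M \<subseteq> \<Omega>" "\<And>z. z \<in> M \<Longrightarrow> h z = m"
  proof -
    show "convex M"
      unfolding M_eq convex_def
    proof clarify
      fix x y and u v :: real
      assume *: "x \<in> \<Omega>" "y \<in> \<Omega>" "h x \<le> m" "h y \<le> m" "0 \<le> u" "0 \<le> v" "u + v = 1"
      then have "h (u *\<^sub>R x + v *\<^sub>R y) \<le> u * h x + v * h y"
        using conv by (simp add: convex_on_def)
      also have "\<dots> \<le> m"
        using * by (intro convex_bound_le)
      finally show "u *\<^sub>R x + v *\<^sub>R y \<in> \<Omega> \<and> h (u *\<^sub>R x + v *\<^sub>R y) \<le> m"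
        using * convexD[OF assms(5)] by blast
    qed
    show "closed M"
      unfolding M_eq using cont assms(4)
      by (intro continuous_on_closed_Collect_le) auto
    show "M \<noteq> {}"
      using assms(7) by (simp add: M_def)
  qed (use M_eq m_le in force)+
  have w\<^sub>0: "h w\<^sub>0 \<le> m + \<epsilon>\<^sub>0"
    using assms(15) fh[OF assms(12)] fmin by simp
  define c where "c = 2 * \<alpha>\<^sup>2 * G\<^sup>2 / (lam * \<epsilon>\<^sub>0)"
  have c: "c > 0"
    using assms by (simp add: c_def)
  show ?thesis
  proof (intro exI[of _ "1 + 1 / c"] conjI allI impI)
    show "1 + 1 / c > 0"
      using c by (simp add: add_pos_pos)
  next
    fix \<epsilon> :: real
    assume "0 < \<epsilon> \<and> \<epsilon> \<le> \<epsilon>\<^sub>0 \<and> semi_strongly_convex_on f \<Omega> lam (sublevel_set f \<Omega> \<epsilon>)"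
    then have \<epsilon>: "0 < \<epsilon>" "\<epsilon> \<le> \<epsilon>\<^sub>0"
      and ssc: "semi_strongly_convex_on f \<Omega> lam (sublevel_set f \<Omega> \<epsilon>)"
      by auto
    have growth: "lam / 2 * (norm (x - closest_point M x))\<^sup>2 \<le> h x - m"
      if "x \<in> \<Omega>" "h x \<le> m + \<epsilon>" for x
    proof -
      have "closest_point M x \<in> M"
        using M by (intro closest_point_in_set)
      then have "f (closest_point M x) = ereal m"
        using fh M by auto
      moreover have "x \<in> sublevel_set f \<Omega> \<epsilon>"
        using that fh fmin by (simp add: sublevel_set_def)
      ultimately show ?thesis
        using ssc fh[OF that(1)]
        unfolding semi_strongly_convex_on_def nearest_minimizer_def M_def by fastforce
    qed
    show "level_set_radius f \<Omega> \<epsilon> \<le> ereal (sqrt (2 * \<epsilon> / lam))"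
    proof -
      have "ereal (norm (w - nearest_minimizer f \<Omega> w)) \<le> ereal (sqrt (2 * \<epsilon> / lam))"
        if "w \<in> level_set f \<Omega> \<epsilon>" for w
      proof -
        have "w \<in> \<Omega>" "h w = m + \<epsilon>"
          using that fh fmin by (auto simp: level_set_def)
        then have "(norm (w - closest_point M w))\<^sup>2 \<le> 2 * \<epsilon> / lam"
          using growth[of w] \<open>lam > 0\<close> by (simp add: field_simps)
        then show ?thesis
          unfolding nearest_minimizer_def M_def[symmetric] by (simp add: real_le_rsqrt)
      qed
      then show ?thesis
        using \<epsilon> \<open>lam > 0\<close> by (auto simp: level_set_radius_def intro!: SUP_least)
    qed
    let ?X = "2 * \<alpha>\<^sup>2 * G\<^sup>2 / (lam * \<epsilon>)" and ?Y = "log \<alpha> (\<epsilon>\<^sub>0 / \<epsilon>)"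
    have optimal: "f (rsg \<Omega> orc \<epsilon>\<^sub>0 G w\<^sub>0 (nat \<lceil>?Y\<rceil>) (nat \<lceil>?X\<rceil>) \<alpha>) - fmin f \<Omega> \<le> ereal (2 * \<epsilon>)"
      if "subgradient_oracle f \<Omega> orc" for orc
    proof -
      let ?w = "rsg \<Omega> orc \<epsilon>\<^sub>0 G w\<^sub>0 (nat \<lceil>?Y\<rceil>) (nat \<lceil>?X\<rceil>) \<alpha>"
      have orc: "bounded_subgradients_on \<Omega> h G (orc k n)" for k n
        using that by (intro sub) (simp add: subgradient_oracle_def)
      have "?X \<le> real (nat \<lceil>?X\<rceil>)"
        by linarith
      then have "?w \<in> \<Omega> \<and> h ?w \<le> m + \<epsilon> + \<epsilon>\<^sub>0 / \<alpha> ^ nat \<lceil>?Y\<rceil>"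
        by (intro rsg_invariant[OF M conv \<open>closed \<Omega>\<close> growth orc]) (use assms \<epsilon> w\<^sub>0 in auto)
      then show ?thesis
        using geometric_error_after_log_stages[of \<alpha> \<epsilon> \<epsilon>\<^sub>0] assms(13,14) \<epsilon> fh fmin by auto
    qed
    have "c \<le> ?X"
      unfolding c_def using \<epsilon> \<open>lam > 0\<close> by (intro divide_left_mono) auto
    moreover have "?Y \<ge> 0"
      using \<epsilon> \<open>\<alpha> > 1\<close> by simp
    ultimately have "real (rsg_iterations (nat \<lceil>?Y\<rceil>) (nat \<lceil>?X\<rceil>)) \<le> (1 + 1 / c) * ?X * of_int \<lceil>?Y\<rceil>"
      by (rule rsg_iterations_le[OF c])
    with optimal
    show "let t = nat \<lceil>?X\<rceil>; K = nat \<lceil>?Y\<rceil>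
          in (\<forall>orc. subgradient_oracle f \<Omega> orc \<longrightarrow>
                f (rsg \<Omega> orc \<epsilon>\<^sub>0 G w\<^sub>0 K t \<alpha>) - fmin f \<Omega> \<le> ereal (2 * \<epsilon>)) \<and>
             real (rsg_iterations K t) \<le> (1 + 1 / c) * ?X * of_int \<lceil>?Y\<rceil>"
      unfolding Let_def by blast
  qed
qed

end
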